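(* Consider a Multi-Level Nested GDP (ML-GDP) with $n\ge 2$ levels, and its Equivalent Single-Level GDP (ME-GDP). Let rML-GDP-BM denote the continuous relaxation of the mixed-integer program obtained from ML-GDP via the Big-M reformulation, and let rME-GDP-BM denote the continuous relaxation of the mixed-integer program obtained from ME-GDP via the Big-M reformulation (all four models are defined in the context). If the tight values of the $M$ parameters (as specified in the context) are used in both reformulations, then the feasible space of the former is contained in the feasible space of the latter, $$\text{rML-GDP-BM}\subseteq\text{rME-GDP-BM},$$ where the feasible space of rME-GDP-BM is taken in the space of the variables it shares with rML-GDP-BM. That is, for every point $\big(x,(y_p)_p\big)$ feasible for rML-GDP-BM there exist values $s_d$ of the slack variables (one for every nested disjunction $d$ of level $k\in\{2,\dots,n\}$) such that $\big(x,(y_p)_p,(s_d)_d\big)$ is feasible for rME-GDP-BM.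
   Context: **Index structure.** Let $n\ge 2$ be the number of levels. $D_1=I^{(1)}$ is a finite set of level-1 disjunctions. Every level-$k$ disjunction $d\in D_k$ has a finite nonempty set $J_d$ of disjuncts; the level-$k$ disjuncts are the pairs $p=(d,j)$ with $d\in D_k$, $j\in J_d$, and $P_k$ denotes the set of them. For $k\ge 2$, every disjunct $p\in P_{k-1}$ has a finite (possibly empty) set $I_p$ of disjunctions nested in it, and $D_k=\{(p,i): p\in P_{k-1}, i\in I_p\}$; the parent of $d=(p,i)\in D_k$ is the disjunct $\pi(d)=p\in P_{k-1}$. Let $P=\bigcup_{k=1}^n P_k$. For $p\in P_k$ let $p_1\in P_1,\ p_2\in P_2,\dots,\ p_k=p$ be the chain of disjuncts containing $p$, from level 1 down to $p$ itself (so if $p_{l+1}=(d,j)$ then $p_l=\pi(d)$). **Data.** $x\in\mathbb{R}^N$ is bounded by $x^{LB}\le x\le x^{UB}$ (finite vectors; all vector inequalities are componentwise). The objective $f(x)$, the global constraint functions $r(x)$, and the (vector-valued) constraint functions $g_p(x)$, $p\in P$, are continuous and differentiable. $\Omega$ is a set of logic constraints on the Booleans $Y_p$, $p\in P$, whose algebraic form in terms of the associated binaries $y=(y_p)_{p\in P}$ is a linear system $Ay\le c$. **Cardinality predicate.** $\Xi(m,\,Y_s\ \forall s\in S)$ means that exactly $m$ of the Booleans $Y_s$ are True; when $m$ is replaced by a Boolean $Y$, it stands for $1$ if $Y$ is True and $0$ if $Y$ is False. **ML-GDP.** Minimize $f(x)$ subject to $r(x)\le 0$; for each $d\in D_1$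 the disjunction over $j\in J_d$ of disjuncts in which, with $p=(d,j)$, the indicator Boolean $Y_p$ enforces $g_p(x)\le 0$ together with all nested disjunctions $(p,i)$, $i\in I_p$, which recursively have the same form down to level $n$; $\Xi(1,Y_{(d,j)}\ \forall j\in J_d)$ for $d\in D_1$; $\Xi(Y_{\pi(d)},Y_{(d,j)}\ \forall j\in J_d)$ for $d\in D_k$, $k\ge 2$; $\Omega(Y)$; and $x^{LB}\le x\le x^{UB}$. **ME-GDP.** The nested disjunctions are extracted to the top level: for each $d\in D_1$ the disjunction $\bigvee_{j\in J_d}[Y_{(d,j)};\ g_{(d,j)}(x)\le 0]$, and for each $d\in D_k$, $k\ge 2$, the disjunction $\big(\bigvee_{j\in J_d}[Y_{(d,j)};\ g_{(d,j)}(x)\le 0]\big)\vee[S_d;\ x^{LB}\le x\le x^{UB}]$ with an extra slack Boolean $S_d$. The logic constraints are those of ML-GDP plus $\Xi(1,\{S_d\}\cup\{Y_{(d,j)}: j\in J_d\})$ for $d\in D_k$, $k\ge 2$. The objective, $r(x)\le 0$, $\Omega(Y)$ and the bounds on $x$ are as in ML-GDP. **Tight $M$ values.** For $p\in P_k$ and $0\le l\le k-1$ define (componentwise if $g_p$ is vector-valued) $$\mu_{p,l}=\max\{g_p(x)\ :\ r(x)\le 0,\ g_{p_1}(x)\le 0,\dots,g_{p_l}(x)\le 0,\ x^{LB}\le x\le x^{UB},\ x\in\mathbb{R}^N\}.$$ Thus $\mu_{p,0}$ uses only the global constraints and bounds, and $\mu_{p,k-1}$ uses in addition the constraints of all ancestor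 disjuncts of $p$. The feasible sets in these maximization problems are assumed nonempty, so that all values are well defined. **Big-M reformulation of ML-GDP (continuous relaxation rML-GDP-BM).** Variables $x\in\mathbb{R}^N$ and $y_p\in[0,1]$ (binary before relaxation), $p\in P$. Constraints: - $r(x)\le 0$, $x^{LB}\le x\le x^{UB}$, $Ay\le c$; - for every $k$ and $p\in P_k$: $\ g_p(x)\le \mu_{p,k-1}\,(1-y_{p})+\sum_{l=1}^{k-1}(\mu_{p,l-1}-\mu_{p,l})\,(1-y_{p_l})$; - $\sum_{j\in J_d}y_{(d,j)}=1$ for $d\in D_1$; $\sum_{j\in J_d}y_{(d,j)}=y_{\pi(d)}$ for $d\in D_k$, $k\ge 2$. (For two levels, a level-2 constraint $h(x)\le 0$ with binary $w$ and parent binary $y$ becomes $h(x)\le m'(1-w)+M'(1-y)$, where $m'$ is the maximum of $h$ subject to the global constraints, the bounds and the parent's constraints, and $M'$ is the maximum of $h$ subject to the global constraints and bounds, minus $m'$.) **Big-M reformulation of ME-GDP (continuous relaxation rME-GDP-BM).** Variables $x\in\mathbb{R}^N$, $y_p\in[0,1]$ for $p\in P$, and $s_d\in[0,1]$ for $d\in D_k$, $k\ge 2$ (the $y_p$ and $s_d$ being binary before relaxation). Constraints: - $r(x)\le 0$, $x^{LB}\le x\le x^{UB}$, $Ay\le c$; - $g_p(x)\le\mu_{p,0}\,(1-y_p)$ for every $p\in P$; - $\sum_{j\in J_d}y_{(d,j)}=1$ for $d\in D_1$; $\sum_{j\in J_d}y_{(d,j)}=y_{\pi(d)}$ and $s_d+\sum_{j\in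 J_d}y_{(d,j)}=1$ for $d\in D_k$, $k\ge 2$. *)

theory Defs
  imports "HOL-Analysis.Analysis"
begin

section \<open>Index structure\<close>

text \<open>
  \<open>Disjunct d j\<close> is the pair \<open>(d, j)\<close> and \<open>Nested p i\<close> is the pair \<open>(p, i)\<close>, whose
  \<open>parent\<close> is \<open>p\<close>; \<open>Top i\<close> is a level-1 disjunction, which has no parent.
\<close>

datatype ('i, 'j) disjunction =
    Top 'i
  | Nested (parent: "('i, 'j) disjunct") 'i
and ('i, 'j) disjunct =
    Disjunct "('i, 'j) disjunction" 'j

text \<open>
  \<open>chain p\<close> is the list \<open>[p\<^sub>1, \<dots>, p\<^sub>k]\<close> of the disjuncts containing \<open>p\<close>, from level 1 down to
  \<open>p\<^sub>k = p\<close>; list positions start at 0, whereas levels start at 1.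
\<close>

primrec chain :: "('i, 'j) disjunct \<Rightarrow> ('i, 'j) disjunct list"
  and chain_above :: "('i, 'j) disjunction \<Rightarrow> ('i, 'j) disjunct list" where
  "chain (Disjunct d j) = chain_above d @ [Disjunct d j]"
| "chain_above (Top i) = []"
| "chain_above (Nested p i) = chain p"

definition ancestor :: "('i, 'j) disjunct \<Rightarrow> nat \<Rightarrow> ('i, 'j) disjunct" where
  "ancestor p l = chain p ! (l - 1)"

section \<open>Problem data\<close>

text \<open>
  The vector-valued functions \<open>r\<close> and \<open>g\<^sub>p\<close> are given by their components: component \<open>i\<close> of
  \<open>r\<close> is \<open>r_fun G i\<close> for \<open>i < r_dim G\<close>, and component \<open>i\<close> of \<open>g\<^sub>p\<close> is \<open>g_fun G p i\<close> for
  \<open>i < g_dim G p\<close>.  The linear system \<open>A y \<le> c\<close> has the rows \<open>i < log_rows G\<close>.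
\<close>

record ('i, 'j, 'v::finite) ml_gdp =
  levels :: nat
  I_top :: "'i set"
  I_set :: "('i, 'j) disjunct \<Rightarrow> 'i set"
  J_set :: "('i, 'j) disjunction \<Rightarrow> 'j set"
  x_lb :: "real ^ 'v"
  x_ub :: "real ^ 'v"
  objective :: "real ^ 'v \<Rightarrow> real"
  r_dim :: nat
  r_fun :: "nat \<Rightarrow> real ^ 'v \<Rightarrow> real"
  g_dim :: "('i, 'j) disjunct \<Rightarrow> nat"
  g_fun :: "('i, 'j) disjunct \<Rightarrow> nat \<Rightarrow> real ^ 'v \<Rightarrow> real"
  logic :: "(('i, 'j) disjunct \<Rightarrow> bool) \<Rightarrow> bool"
  log_rows :: nat
  log_mat :: "nat \<Rightarrow> ('i, 'j) disjunct \<Rightarrow> real"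
  log_rhs :: "nat \<Rightarrow> real"

definition disjuncts_of ::
  "('i, 'j, 'v::finite) ml_gdp \<Rightarrow> ('i, 'j) disjunction set \<Rightarrow> ('i, 'j) disjunct set" where
  "disjuncts_of G E = {Disjunct d j | d j. d \<in> E \<and> j \<in> J_set G d}"

fun D_level :: "('i, 'j, 'v::finite) ml_gdp \<Rightarrow> nat \<Rightarrow> ('i, 'j) disjunction set" where
  "D_level G 0 = {}"
| "D_level G (Suc 0) = Top ` I_top G"
| "D_level G (Suc (Suc k)) =
     {Nested p i | p i. p \<in> disjuncts_of G (D_level G (Suc k)) \<and> i \<in> I_set G p}"

definition P_level :: "('i, 'j, 'v::finite) ml_gdp \<Rightarrow> nat \<Rightarrow> ('i, 'j) disjunct set" where
  "P_level G k = disjuncts_of G (D_level G k)"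

definition P_all :: "('i, 'j, 'v::finite) ml_gdp \<Rightarrow> ('i, 'j) disjunct set" where
  "P_all G = (\<Union>k\<in>{1..levels G}. P_level G k)"

definition D_nested :: "('i, 'j, 'v::finite) ml_gdp \<Rightarrow> ('i, 'j) disjunction set" where
  "D_nested G = (\<Union>k\<in>{2..levels G}. D_level G k)"

definition r_ok :: "('i, 'j, 'v::finite) ml_gdp \<Rightarrow> real ^ 'v \<Rightarrow> bool" where
  "r_ok G x \<longleftrightarrow> (\<forall>i<r_dim G. r_fun G i x \<le> 0)"

definition g_ok :: "('i, 'j, 'v::finite) ml_gdp \<Rightarrow> ('i, 'j) disjunct \<Rightarrow> real ^ 'v \<Rightarrow> bool" where
  "g_ok G p x \<longleftrightarrow> (\<forall>i<g_dim G p. g_fun G p i x \<le> 0)"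

definition bounds_ok :: "('i, 'j, 'v::finite) ml_gdp \<Rightarrow> real ^ 'v \<Rightarrow> bool" where
  "bounds_ok G x \<longleftrightarrow> x_lb G \<le> x \<and> x \<le> x_ub G"

definition linear_logic_ok :: "('i, 'j, 'v::finite) ml_gdp \<Rightarrow> (('i, 'j) disjunct \<Rightarrow> real) \<Rightarrow> bool" where
  "linear_logic_ok G y \<longleftrightarrow>
     (\<forall>i<log_rows G. (\<Sum>p\<in>P_all G. log_mat G i p * y p) \<le> log_rhs G i)"

text \<open>The feasible set of the maximization problem defining \<open>\<mu>\<^sub>p\<^sub>,\<^sub>l\<close>.\<close>

definition mu_region :: "('i, 'j, 'v::finite) ml_gdp \<Rightarrow> ('i, 'j) disjunct \<Rightarrow> nat \<Rightarrow> (real ^ 'v) set" where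
  "mu_region G p l =
     {x. r_ok G x \<and> (\<forall>m\<in>{1..l}. g_ok G (ancestor p m) x) \<and> bounds_ok G x}"

definition mu :: "('i, 'j, 'v::finite) ml_gdp \<Rightarrow> ('i, 'j) disjunct \<Rightarrow> nat \<Rightarrow> nat \<Rightarrow> real" where
  "mu G p l i = (GREATEST v. v \<in> g_fun G p i ` mu_region G p l)"

text \<open>
  The logic constraints and their algebraic form agree on the Booleans; since the latter only
  involves the \<open>y\<^sub>p\<close> with \<open>p \<in> P\<close>, so does the former.
\<close>

definition well_formed :: "('i, 'j, 'v::finite) ml_gdp \<Rightarrow> bool" where
  "well_formed G \<longleftrightarrow>
     levels G \<ge> 2 \<and>
     finite (I_top G) \<and>
     (\<forall>k\<in>{1..levels G}. \<forall>d\<in>D_level G k. finite (J_set G d) \<and> J_set G d \<noteq> {}) \<and>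
     (\<forall>k\<in>{2..levels G}. \<forall>p\<in>P_level G (k - 1). finite (I_set G p)) \<and>
     continuous_on UNIV (objective G) \<and> objective G differentiable_on UNIV \<and>
     (\<forall>i<r_dim G. continuous_on UNIV (r_fun G i) \<and> r_fun G i differentiable_on UNIV) \<and>
     (\<forall>p\<in>P_all G. \<forall>i<g_dim G p.
        continuous_on UNIV (g_fun G p i) \<and> g_fun G p i differentiable_on UNIV) \<and>
     (\<forall>Y. logic G Y \<longleftrightarrow> linear_logic_ok G (\<lambda>p. of_bool (Y p))) \<and>
     (\<forall>k\<in>{1..levels G}. \<forall>p\<in>P_level G k. \<forall>l\<le>k - 1. mu_region G p l \<noteq> {})"

section \<open>The disjunctive programs\<close>

definition Xi :: "nat \<Rightarrow> ('s \<Rightarrow> bool) \<Rightarrow> 's set \<Rightarrow> bool" where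
  "Xi m Y S \<longleftrightarrow> card {s \<in> S. Y s} = m"

text \<open>
  \<open>disjunct_holds G x Y m p\<close>: the disjunct \<open>p\<close> is active, with \<open>m\<close> further levels below it.
\<close>

primrec disjunct_holds ::
  "('i, 'j, 'v::finite) ml_gdp \<Rightarrow> real ^ 'v \<Rightarrow> (('i, 'j) disjunct \<Rightarrow> bool) \<Rightarrow>
   nat \<Rightarrow> ('i, 'j) disjunct \<Rightarrow> bool" where
  "disjunct_holds G x Y 0 p \<longleftrightarrow> Y p \<and> g_ok G p x"
| "disjunct_holds G x Y (Suc m) p \<longleftrightarrow> Y p \<and> g_ok G p x \<and>
     (\<forall>i\<in>I_set G p. \<exists>j\<in>J_set G (Nested p i). disjunct_holds G x Y m (Disjunct (Nested p i) j))"

definition logic_ok :: "('i, 'j, 'v::finite) ml_gdp \<Rightarrow> (('i, 'j) disjunct \<Rightarrow> bool) \<Rightarrow> bool" where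
  "logic_ok G Y \<longleftrightarrow>
     (\<forall>d\<in>D_level G 1. Xi 1 (\<lambda>j. Y (Disjunct d j)) (J_set G d)) \<and>
     (\<forall>d\<in>D_nested G. Xi (of_bool (Y (parent d))) (\<lambda>j. Y (Disjunct d j)) (J_set G d)) \<and>
     logic G Y"

text \<open>
  In \<open>gdp_ME\<close>, the index \<open>None\<close> stands for the slack \<open>S\<^sub>d\<close> in the family
  \<open>{S\<^sub>d} \<union> {Y\<^sub>(\<^sub>d\<^sub>,\<^sub>j\<^sub>) : j \<in> J\<^sub>d}\<close>.
\<close>

definition gdp_ML ::
  "('i, 'j, 'v::finite) ml_gdp \<Rightarrow> ((real ^ 'v) \<times> (('i, 'j) disjunct \<Rightarrow> bool)) set" where
  "gdp_ML G = {(x, Y).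
     r_ok G x \<and> bounds_ok G x \<and> logic_ok G Y \<and>
     (\<forall>d\<in>D_level G 1. \<exists>j\<in>J_set G d. disjunct_holds G x Y (levels G - 1) (Disjunct d j))}"

definition gdp_ME ::
  "('i, 'j, 'v::finite) ml_gdp \<Rightarrow>
   ((real ^ 'v) \<times> (('i, 'j) disjunct \<Rightarrow> bool) \<times> (('i, 'j) disjunction \<Rightarrow> bool)) set" where
  "gdp_ME G = {(x, Y, S).
     r_ok G x \<and> bounds_ok G x \<and> logic_ok G Y \<and>
     (\<forall>d\<in>D_nested G. Xi 1 (case_option (S d) (\<lambda>j. Y (Disjunct d j)))
        (insert None (Some ` J_set G d))) \<and>
     (\<forall>d\<in>D_level G 1. \<exists>j\<in>J_set G d. Y (Disjunct d j) \<and> g_ok G (Disjunct d j) x) \<and>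
     (\<forall>d\<in>D_nested G. (\<exists>j\<in>J_set G d. Y (Disjunct d j) \<and> g_ok G (Disjunct d j) x) \<or>
        (S d \<and> bounds_ok G x))}"

section \<open>Big-M reformulations\<close>

text \<open>
  \<open>V\<close> is the range of the indicator variables: \<open>{0, 1}\<close> in the mixed-integer program and
  \<open>{0..1}\<close> in its continuous relaxation.  The indicator vectors are extensional functions, so
  that \<open>y\<close> has exactly one coordinate per disjunct and \<open>s\<close> one per nested disjunction.
\<close>

definition bigM_ML :: "real set \<Rightarrow> ('i, 'j, 'v::finite) ml_gdp \<Rightarrow>
    ((real ^ 'v) \<times> (('i, 'j) disjunct \<Rightarrow> real)) set" where
  "bigM_ML V G = {(x, y).
     y \<in> P_all G \<rightarrow>\<^sub>E V \<and>
     r_ok G x \<and> bounds_ok G x \<and> linear_logic_ok G y \<and>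
     (\<forall>k\<in>{1..levels G}. \<forall>p\<in>P_level G k. \<forall>i<g_dim G p.
        g_fun G p i x \<le> mu G p (k - 1) i * (1 - y p) +
          (\<Sum>l=1..k - 1. (mu G p (l - 1) i - mu G p l i) * (1 - y (ancestor p l)))) \<and>
     (\<forall>d\<in>D_level G 1. (\<Sum>j\<in>J_set G d. y (Disjunct d j)) = 1) \<and>
     (\<forall>d\<in>D_nested G. (\<Sum>j\<in>J_set G d. y (Disjunct d j)) = y (parent d))}"

definition bigM_ME :: "real set \<Rightarrow> ('i, 'j, 'v::finite) ml_gdp \<Rightarrow>
    ((real ^ 'v) \<times> (('i, 'j) disjunct \<Rightarrow> real) \<times> (('i, 'j) disjunction \<Rightarrow> real)) set" where
  "bigM_ME V G = {(x, y, s).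
     y \<in> P_all G \<rightarrow>\<^sub>E V \<and> s \<in> D_nested G \<rightarrow>\<^sub>E V \<and>
     r_ok G x \<and> bounds_ok G x \<and> linear_logic_ok G y \<and>
     (\<forall>p\<in>P_all G. \<forall>i<g_dim G p. g_fun G p i x \<le> mu G p 0 i * (1 - y p)) \<and>
     (\<forall>d\<in>D_level G 1. (\<Sum>j\<in>J_set G d. y (Disjunct d j)) = 1) \<and>
     (\<forall>d\<in>D_nested G. (\<Sum>j\<in>J_set G d. y (Disjunct d j)) = y (parent d) \<and>
        s d + (\<Sum>j\<in>J_set G d. y (Disjunct d j)) = 1)}"

definition rML_GDP_BM :: "('i, 'j, 'v::finite) ml_gdp \<Rightarrow>
    ((real ^ 'v) \<times> (('i, 'j) disjunct \<Rightarrow> real)) set" where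
  "rML_GDP_BM G = bigM_ML {0..1} G"

definition rME_GDP_BM :: "('i, 'j, 'v::finite) ml_gdp \<Rightarrow>
    ((real ^ 'v) \<times> (('i, 'j) disjunct \<Rightarrow> real) \<times> (('i, 'j) disjunction \<Rightarrow> real)) set" where
  "rME_GDP_BM G = bigM_ME {0..1} G"

end

(* Along a chain of disjuncts the indicators decrease with the level, since each one is a summand
   of a sum of nonnegative numbers equal to its parent.  The values mu_{p,l} decrease in l, since
   the feasible sets shrink.  Replacing every 1 - y_{p_l} by the larger 1 - y_p therefore weakens the
   multi-level big-M constraint, and the sum telescopes to mu_{p,0} (1 - y_p).  The slacks are
   s_d = 1 - y_{parent d}. *)
theory Submission
  imports Defs
begin

lemma disjunct_in_P_level_iff: "Disjunct d j \<in> P_level G k \<longleftrightarrow> d \<in> D_level G k \<and> j \<in> J_set G d"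
  by (auto simp: P_level_def disjuncts_of_def)

lemma P_level_subset_P_all:
  assumes "k \<in> {1..levels G}"
  shows "P_level G k \<subseteq> P_all G"
  using assms by (auto simp: P_all_def)

lemma P_level_1_cases:
  assumes "p \<in> P_level G (Suc 0)"
  obtains i j where "p = Disjunct (Top i) j"
  using assms by (auto simp: P_level_def disjuncts_of_def)

lemma P_level_Suc_cases:
  assumes "p \<in> P_level G (Suc (Suc k))"
  obtains q i j where "p = Disjunct (Nested q i) j" "q \<in> P_level G (Suc k)"
    "Nested q i \<in> D_level G (Suc (Suc k))" "j \<in> J_set G (Nested q i)"
  using assms by (auto simp: P_level_def disjuncts_of_def)

text \<open>Ties the level in \<open>P_level\<close> to the list length, so that
  \<open>ancestor p l\<close> with \<open>l\<close> in \<open>{1..Suc k}\<close> never reads past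
  the end of \<open>chain p\<close>.\<close>

lemma length_chain:
  assumes "p \<in> P_level G (Suc k)"
  shows "length (chain p) = Suc k"
  using assms
proof (induction k arbitrary: p)
  case 0
  then show ?case by (auto elim: P_level_1_cases)
next
  case (Suc k)
  then show ?case by (auto elim!: P_level_Suc_cases)
qed

lemma ancestor_self:
  assumes "p \<in> P_level G (Suc k)"
  shows "ancestor p (Suc k) = p"
proof -
  obtain d j where p: "p = Disjunct d j"
    by (cases p)
  show ?thesis
    using length_chain[OF assms] by (simp add: ancestor_def p nth_append)
qed

text \<open>The chain of the nested disjunct is \<open>chain q\<close> with one entry appended, so
  earlier positions are unchanged. This carries inductions on the level from a disjunct to its
  parent.\<close>

lemma ancestor_nested:
  assumes "q \<in> P_level G k" "l \<in> {1..k}"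
  shows "ancestor (Disjunct (Nested q i) j) l = ancestor q l"
proof -
  obtain m where "k = Suc m"
    using assms(2) by (cases k) auto
  then show ?thesis
    using length_chain[of q G m] assms by (auto simp: ancestor_def nth_append)
qed

text \<open>Makes the regularity assumptions on disjuncts in \<open>P_all\<close> available for
  ancestors. Either \<open>l\<close> is the last position, or the parent has the same ancestor at
  \<open>l\<close>.\<close>

lemma ancestor_in_P_level:
  assumes "p \<in> P_level G k" "l \<in> {1..k}"
  shows "ancestor p l \<in> P_level G l"
  using assms
proof (induction k arbitrary: p)
  case 0
  then show ?case by simp
next
  case (Suc k)
  show ?case
  proof (cases "l = Suc k")
    case True
    then show ?thesis
      using ancestor_self Suc.prems(1) by metis
  next
    case False
    then obtain m where m: "k = Suc m"
      using Suc.prems(2) by (cases k) auto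
    with Suc.prems(1) obtain q i j where q: "p = Disjunct (Nested q i) j" "q \<in> P_level G k"
      by (auto elim: P_level_Suc_cases)
    with Suc.IH[OF q(2)] ancestor_nested[OF q(2)] False Suc.prems(2) show ?thesis
      by auto
  qed
qed

lemma indicator_le_ancestor:
  fixes y :: "('i, 'j) disjunct \<Rightarrow> real"
  assumes fin: "\<And>d. d \<in> D_nested G \<Longrightarrow> finite (J_set G d)"
    and nonneg: "\<And>p. p \<in> P_all G \<Longrightarrow> 0 \<le> y p"
    and sum_eq: "\<And>d. d \<in> D_nested G \<Longrightarrow> (\<Sum>j\<in>J_set G d. y (Disjunct d j)) = y (parent d)"
    and p: "p \<in> P_level G k" and k: "k \<le> levels G" and l: "l \<in> {1..k}"
  shows "y p \<le> y (ancestor p l)"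
  using p k l
proof (induction k arbitrary: p)
  case 0
  then show ?case by simp
next
  case (Suc k)
  show ?case
  proof (cases "l = Suc k")
    case True
    then show ?thesis
      using ancestor_self[OF Suc.prems(1)] by simp
  next
    case False
    then obtain m where m: "k = Suc m"
      using Suc.prems(3) by (cases k) auto
    with Suc.prems(1) obtain q i j where q: "p = Disjunct (Nested q i) j" "q \<in> P_level G k"
      and d: "Nested q i \<in> D_level G (Suc k)" and j: "j \<in> J_set G (Nested q i)"
      by (auto elim: P_level_Suc_cases)
    \<comment> \<open>Since \<open>k = Suc m\<close>, the level \<open>Suc k\<close> is at least 2,
      where sums equal the parent indicator.\<close>
    have d_nested: "Nested q i \<in> D_nested G"
      unfolding D_nested_def using d Suc.prems(2) m by (intro UN_I[of "Suc k"]) auto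
    \<comment> \<open>With nonnegative siblings, one summand is at most the whole sum.\<close>
    have "0 \<le> y (Disjunct (Nested q i) j')" if "j' \<in> J_set G (Nested q i)" for j'
      using that d Suc.prems(2) P_level_subset_P_all[of "Suc k" G]
      by (intro nonneg) (auto simp: disjunct_in_P_level_iff)
    then have "y p \<le> (\<Sum>j\<in>J_set G (Nested q i). y (Disjunct (Nested q i) j))"
      unfolding q(1) using j fin[OF d_nested] by (intro member_le_sum) auto
    also have "\<dots> = y q"
      using sum_eq[OF d_nested] by simp
    also have "\<dots> \<le> y (ancestor q l)"
      using Suc.IH[OF q(2)] Suc.prems False by auto
    finally show ?thesis
      using ancestor_nested[OF q(2)] Suc.prems(3) False by (auto simp: q(1))
  qed
qed

text \<open>The finite bounds give a compact box, and continuity makes each remaining constraint cut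
  out a closed set.\<close>

lemma compact_mu_region:
  assumes wf: "well_formed G" and k: "k \<in> {1..levels G}" and p: "p \<in> P_level G k"
    and l: "l \<le> k - 1"
  shows "compact (mu_region G p l)"
proof -
  have "mu_region G p l = cbox (x_lb G) (x_ub G) \<inter> (\<Inter>i\<in>{..<r_dim G}. {x. r_fun G i x \<le> 0}) \<inter>
      (\<Inter>m\<in>{1..l}. \<Inter>i\<in>{..<g_dim G (ancestor p m)}. {x. g_fun G (ancestor p m) i x \<le> 0})"
    by (auto simp: mu_region_def r_ok_def g_ok_def bounds_ok_def mem_box_cart less_eq_vec_def)
  moreover have "closed {x. r_fun G i x \<le> 0}" if "i < r_dim G" for i
    using wf that unfolding well_formed_def by (intro closed_Collect_le) auto
  moreover have "closed {x. g_fun G (ancestor p m) i x \<le> 0}"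
    if m: "m \<in> {1..l}" and i: "i < g_dim G (ancestor p m)" for m i
  proof -
    have "m \<in> {1..k}" "m \<in> {1..levels G}"
      using m l k by auto
    then have "ancestor p m \<in> P_all G"
      using ancestor_in_P_level[OF p] P_level_subset_P_all by blast
    then show ?thesis
      using wf i unfolding well_formed_def by (intro closed_Collect_le) auto
  qed
  ultimately show ?thesis
    by (auto intro!: compact_Int_closed closed_INT)
qed

text \<open>\<open>GREATEST\<close> is informative only if a greatest value exists; the extreme
  value theorem on the nonempty compact region provides it.\<close>

lemma mu_is_max:
  assumes wf: "well_formed G" and k: "k \<in> {1..levels G}" and p: "p \<in> P_level G k"
    and l: "l \<le> k - 1" and i: "i < g_dim G p"
  shows mu_attained: "mu G p l i \<in> g_fun G p i ` mu_region G p l"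
    and mu_upper: "\<And>x. x \<in> mu_region G p l \<Longrightarrow> g_fun G p i x \<le> mu G p l i"
proof -
  have "continuous_on (mu_region G p l) (g_fun G p i)"
    using wf i p P_level_subset_P_all[OF k] unfolding well_formed_def
    by (meson continuous_on_subset subset_UNIV subsetD)
  moreover have "mu_region G p l \<noteq> {}"
    using wf k p l unfolding well_formed_def by blast
  ultimately obtain x where x: "x \<in> mu_region G p l"
    and max: "\<And>z. z \<in> mu_region G p l \<Longrightarrow> g_fun G p i z \<le> g_fun G p i x"
    using continuous_attains_sup[OF compact_mu_region[OF wf k p l]] by blast
  have "mu G p l i = g_fun G p i x"
    unfolding mu_def using x max by (intro Greatest_equality) auto
  then show "mu G p l i \<in> g_fun G p i ` mu_region G p l"
    and "\<And>z. z \<in> mu_region G p l \<Longrightarrow> g_fun G p i z \<le> mu G p l i"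
    using x max by auto
qed

lemma mu_antimono:
  assumes wf: "well_formed G" and k: "k \<in> {1..levels G}" and p: "p \<in> P_level G k"
    and "l \<le> l'" "l' \<le> k - 1" and i: "i < g_dim G p"
  shows "mu G p l' i \<le> mu G p l i"
proof -
  \<comment> \<open>A maximizer under the constraints up to \<open>l'\<close> remains feasible when
    only those up to \<open>l\<close> are kept.\<close>
  obtain x where x: "x \<in> mu_region G p l'" "mu G p l' i = g_fun G p i x"
    using mu_attained[OF wf k p \<open>l' \<le> k - 1\<close> i] by blast
  have "x \<in> mu_region G p l"
    using x(1) \<open>l \<le> l'\<close> by (auto simp: mu_region_def)
  then show ?thesis
    using mu_upper[OF wf k p _ i] x(2) assms(4,5) by simp
qed

text \<open>To be used with \<open>a l\<close> as \<open>mu G p l i\<close>, \<open>b l\<close> as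
  \<open>1 - y (ancestor p l)\<close> and \<open>c\<close> as \<open>1 - y p\<close>. Only the
  differences of \<open>a\<close> must be nonnegative; the values of \<open>a\<close> may be
  negative.\<close>

lemma weighted_telescope_le:
  fixes a b :: "nat \<Rightarrow> real"
  assumes "\<And>l. l \<in> {1..m} \<Longrightarrow> a l \<le> a (l - 1)" and "\<And>l. l \<in> {1..m} \<Longrightarrow> b l \<le> c"
  shows "a m * c + (\<Sum>l=1..m. (a (l - 1) - a l) * b l) \<le> a 0 * c"
  using assms
proof (induction m)
  case 0
  then show ?case by simp
next
  case (Suc m)
  \<comment> \<open>Raising \<open>b (Suc m)\<close> to \<open>c\<close> merges the last summand
    with the leading term, leaving the same expression for \<open>m\<close>.\<close>
  have "a (Suc m) * c + (a m - a (Suc m)) * b (Suc m) \<le> a m * c"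
    using mult_left_mono[of "b (Suc m)" c "a m - a (Suc m)"] Suc.prems(1)[of "Suc m"]
      Suc.prems(2)[of "Suc m"] by (simp add: algebra_simps)
  then show ?case
    using Suc.IH Suc.prems by simp
qed

theorem theorem2:
  fixes G :: "('i, 'j, 'v::finite) ml_gdp"
  assumes "well_formed G"
  shows "rML_GDP_BM G \<subseteq> (\<lambda>(x, y, s). (x, y)) ` rME_GDP_BM G"
proof clarify
  fix x :: "real ^ 'v" and y :: "('i, 'j) disjunct \<Rightarrow> real"
  assume "(x, y) \<in> rML_GDP_BM G"
  then have y: "y \<in> P_all G \<rightarrow>\<^sub>E {0..1}"
    and ok: "r_ok G x" "bounds_ok G x" "linear_logic_ok G y"
    and bigM: "\<And>k p i. k \<in> {1..levels G} \<Longrightarrow> p \<in> P_level G k \<Longrightarrow> i < g_dim G p \<Longrightarrow>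
        g_fun G p i x \<le> mu G p (k - 1) i * (1 - y p) +
          (\<Sum>l=1..k - 1. (mu G p (l - 1) i - mu G p l i) * (1 - y (ancestor p l)))"
    and top: "\<And>d. d \<in> D_level G 1 \<Longrightarrow> (\<Sum>j\<in>J_set G d. y (Disjunct d j)) = 1"
    and nested: "\<And>d. d \<in> D_nested G \<Longrightarrow> (\<Sum>j\<in>J_set G d. y (Disjunct d j)) = y (parent d)"
    unfolding rML_GDP_BM_def bigM_ML_def by blast+
  have y01: "0 \<le> y p \<and> y p \<le> 1" if "p \<in> P_all G" for p
    using PiE_mem[OF y that] by simp
  have fin: "finite (J_set G d)" if "d \<in> D_nested G" for d
    using that assms unfolding D_nested_def well_formed_def by force
  have parent_in: "parent d \<in> P_all G" if d: "d \<in> D_nested G" for d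
  proof -
    obtain k where k: "k \<in> {2..levels G}" "d \<in> D_level G k"
      using d unfolding D_nested_def by blast
    \<comment> \<open>Level at least 2 forces the form \<open>Nested p i\<close>, on which
      \<open>parent\<close> is specified, and places the parent at level
      \<open>Suc m\<close>.\<close>
    then obtain m where m: "k = Suc (Suc m)"
      by (metis atLeastAtMost_iff numeral_2_eq_2 Suc_le_D Suc_le_mono)
    with k have "parent d \<in> P_level G (Suc m)"
      by (auto simp: P_level_def)
    then show ?thesis
      using P_level_subset_P_all[of "Suc m" G] k m by auto
  qed
  \<comment> \<open>The only possible choice: the sum over \<open>J_set G d\<close> is
    \<open>y (parent d)\<close>, and adding \<open>s d\<close> must give 1. The restricted lambda
    supplies the extensionality that \<open>bigM_ME\<close> demands.\<close>
  define s where "s = (\<lambda>d\<in>D_nested G. 1 - y (parent d))"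
  have "s \<in> D_nested G \<rightarrow>\<^sub>E {0..1}"
    using y01[OF parent_in] by (auto simp: s_def)
  moreover have "g_fun G p i x \<le> mu G p 0 i * (1 - y p)"
    if p_in: "p \<in> P_all G" and i: "i < g_dim G p" for p i
  proof -
    obtain k where k: "k \<in> {1..levels G}" and p: "p \<in> P_level G k"
      using p_in by (auto simp: P_all_def)
    have "g_fun G p i x \<le> mu G p (k - 1) i * (1 - y p) +
          (\<Sum>l=1..k - 1. (mu G p (l - 1) i - mu G p l i) * (1 - y (ancestor p l)))"
      by (rule bigM[OF k p i])
    also have "\<dots> \<le> mu G p 0 i * (1 - y p)"
    \<comment> \<open>The telescope has length \<open>k - 1\<close>, the number of proper ancestors
      of \<open>p\<close>.\<close>
    proof (rule weighted_telescope_le[where a = "\<lambda>l. mu G p l i"])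
      fix l assume l: "l \<in> {1..k - 1}"
      then show "mu G p l i \<le> mu G p (l - 1) i"
        by (intro mu_antimono[OF assms k p _ _ i]) auto
      show "1 - y (ancestor p l) \<le> 1 - y p"
        using indicator_le_ancestor[where y = y and l = l, OF fin _ nested p] y01 k l by auto
    qed
    finally show ?thesis .
  qed
  ultimately have "(x, y, s) \<in> rME_GDP_BM G"
    using y ok top nested by (simp add: rME_GDP_BM_def bigM_ME_def s_def)
  then show "(x, y) \<in> (\<lambda>(x, y, s). (x, y)) ` rME_GDP_BM G"
    by (force simp: image_iff)
qed

end
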